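(* Let $K>0$ and let $f:\mathbb{R}^n\to\mathbb{R}$ be proper and globally $K$-Lipschitz continuous, i.e. $|f(y)-f(x)|\le K\|y-x\|$ for all $x,y\in\mathbb{R}^n$. Then $f$ is prox-bounded with threshold of prox-boundedness $\bar r=0$.
   Context: $\mathbb{R}^n$ is equipped with an inner product $\langle\cdot,\cdot\rangle$ and the induced norm $\|\cdot\|$. For $f:\mathbb{R}^n\to\mathbb{R}\cup\{+\infty\}$ and $r\ge 0$, the Moreau envelope of $f$ is $e_rf(x)=\inf_{y\in\mathbb{R}^n}\{f(y)+\frac r2\|y-x\|^2\}$. The function $f$ is prox-bounded if there exists $r\ge0$ such that $e_rf(x)>-\infty$ for some $x\in\mathbb{R}^n$; the infimum of all such $r\ge 0$ is called the threshold of prox-boundedness of $f$. Proper means not identically $+\infty$ and never $-\infty$. *)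

theory Defs
  imports "HOL-Analysis.Analysis"
begin

definition proper_fun :: "('a \<Rightarrow> ereal) \<Rightarrow> bool"
  where "proper_fun f \<longleftrightarrow> (\<exists>x. f x \<noteq> \<infinity>) \<and> (\<forall>x. f x \<noteq> -\<infinity>)"

definition moreau_envelope :: "real \<Rightarrow> ('a::euclidean_space \<Rightarrow> ereal) \<Rightarrow> 'a \<Rightarrow> ereal"
  where "moreau_envelope r f x = (INF y. f y + ereal (r / 2 * (norm (y - x))\<^sup>2))"

definition prox_parameters :: "('a::euclidean_space \<Rightarrow> ereal) \<Rightarrow> real set"
  where "prox_parameters f = {r. 0 \<le> r \<and> (\<exists>x. moreau_envelope r f x > -\<infinity>)}"

definition prox_bounded :: "('a::euclidean_space \<Rightarrow> ereal) \<Rightarrow> bool"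
  where "prox_bounded f \<longleftrightarrow> (\<exists>r. r \<in> prox_parameters f)"

(* The infimum is taken in the extended reals, so that the threshold is infinite
   (rather than unspecified) when f is not prox-bounded. *)
definition prox_threshold :: "('a::euclidean_space \<Rightarrow> ereal) \<Rightarrow> ereal"
  where "prox_threshold f = (INF r\<in>prox_parameters f. ereal r)"

end

theory Submission imports Defs begin

text \<open>
  A \<open>K\<close>-Lipschitz function can decrease at most linearly away from a point \<open>x\<close>, while the
  penalty \<open>(r / 2) * (norm (y - x))\<^sup>2\<close> grows quadratically for every \<open>r > 0\<close>, however small. The
  quadratic therefore wins, and the Moreau envelope at \<open>x\<close> is finite for each positive \<open>r\<close>
  (lemma \<open>moreau_envelope_lower_bound\<close>). So all positive reals are prox parameters, which gives
  prox-boundedness, and the infimum of the parameters is \<open>0\<close> whether or not \<open>r = 0\<close> is itself one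
  of them (it is not, for instance, when \<open>f\<close> is a nonzero linear functional).
\<close>

text \<open>
  Completing the square: over all reals \<open>t\<close>, so in particular for \<open>t = norm (y - x)\<close>, the value of
  \<open>- K * t + (r / 2) * t\<^sup>2\<close> is at least \<open>- K\<^sup>2 / (2 * r)\<close>, which is attained at \<open>t = K / r\<close>.
\<close>

lemma moreau_envelope_lower_bound:
  fixes f :: "'a::euclidean_space \<Rightarrow> real"
  assumes "r > 0" and minorant: "\<And>y. f y \<ge> c - K * norm (y - x)"
  shows "moreau_envelope r (\<lambda>y. ereal (f y)) x \<ge> ereal (c - K\<^sup>2 / (2 * r))"
  unfolding moreau_envelope_def
proof (rule INF_greatest)
  fix y
  have "r / 2 * (norm (y - x))\<^sup>2 - K * norm (y - x) + K\<^sup>2 / (2 * r)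
      = r / 2 * (norm (y - x) - K / r)\<^sup>2"
    using \<open>r > 0\<close> by (simp add: field_simps power2_eq_square)
  also have "\<dots> \<ge> 0"
    using \<open>r > 0\<close> by simp
  finally have "c - K\<^sup>2 / (2 * r) \<le> f y + r / 2 * (norm (y - x))\<^sup>2"
    using minorant[of y] by linarith
  then show "ereal (c - K\<^sup>2 / (2 * r)) \<le> ereal (f y) + ereal (r / 2 * (norm (y - x))\<^sup>2)"
    by simp
qed

lemma prox_threshold_eq_0:
  assumes "{0<..} \<subseteq> prox_parameters f"
  shows "prox_threshold f = 0"
proof (rule antisym)
  show "prox_threshold f \<le> 0"
  proof (rule ereal_le_epsilon2)
    fix e :: real
    assume "e > 0"
    then have "prox_threshold f \<le> ereal e"
      unfolding prox_threshold_def using assms by (intro INF_lower) auto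
    then show "prox_threshold f \<le> 0 + ereal e"
      by simp
  qed
  show "0 \<le> prox_threshold f"
    unfolding prox_threshold_def by (rule INF_greatest) (simp add: prox_parameters_def)
qed

theorem proposition3p1:
  fixes f :: "'a::euclidean_space \<Rightarrow> real" and K :: real
  assumes "K > 0"
    and "proper_fun (\<lambda>x. ereal (f x))"
    and "\<forall>x y. \<bar>f y - f x\<bar> \<le> K * norm (y - x)"
  shows "prox_bounded (\<lambda>x. ereal (f x)) \<and> prox_threshold (\<lambda>x. ereal (f x)) = 0"
proof -
  have "r \<in> prox_parameters (\<lambda>x. ereal (f x))" if "r > 0" for r
  proof -
    have "f y \<ge> f 0 - K * norm (y - 0)" for y
      using assms(3)[rule_format, of y 0] by linarith
    from moreau_envelope_lower_bound[OF \<open>r > 0\<close> this]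
    have "moreau_envelope r (\<lambda>x. ereal (f x)) 0 > -\<infinity>"
      by (rule less_le_trans[rotated]) simp
    then show ?thesis
      using \<open>r > 0\<close> by (auto simp: prox_parameters_def)
  qed
  then have pos: "{0<..} \<subseteq> prox_parameters (\<lambda>x. ereal (f x))"
    by auto
  then have "1 \<in> prox_parameters (\<lambda>x. ereal (f x))"
    by auto
  with prox_threshold_eq_0[OF pos] show ?thesis
    unfolding prox_bounded_def by blast
qed

end
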